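(* Let $\beta$ be a strictly positive modal formula in the single variable $p$, containing $p$, with $\underline d_p(\beta)\ge 1$. Let $\Lambda\in\{\mathrm{K4}_{\Diamond\beta},\mathrm{wK4}_{\Diamond\beta}\}$ and let $n\geq 1$ be such that $\Lambda$ is $n$-transitive. Then each of the following four logics is equal to $\mathrm{GL}_{\Diamond\beta}$: \begin{enumerate} \item $\Lambda_1:=\Lambda+\bigl(\Diamond^{+n}p\to\Diamond^{+n}(p\wedge\neg\Diamond^{+n}p)\bigr)$; \item $\Lambda_2:=\Lambda+\bigl(\Diamond p\to\Diamond^{+n}(p\wedge\neg\Diamond p)\bigr)$; \item $\Lambda_3:=\Lambda+\dfrac{\Box^{+n}\varphi\to\varphi}{\varphi}$; \item $\Lambda_4:=\Lambda+\dfrac{\Box\varphi\to\varphi}{\varphi}$. \end{enumerate}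
   Context: Modal formulas are built from countably many propositional variables and $\bot$ using $\to$ and a unary modality $\Diamond$; other connectives are abbreviations, $\Box\varphi:=\neg\Diamond\neg\varphi$, $\Diamond^0\varphi:=\varphi$, $\Diamond^{k+1}\varphi:=\Diamond\Diamond^k\varphi$, $\Box^k\varphi:=\neg\Diamond^k\neg\varphi$, $\Diamond^{+n}\varphi:=\bigvee_{k=1}^n\Diamond^k\varphi$, $\Box^{+n}\varphi:=\bigwedge_{k=1}^n\Box^k\varphi$. A (normal modal) logic is a set of formulas containing all classical tautologies, $\Diamond\bot\to\bot$ and $\Diamond(p\vee q)\to\Diamond p\vee\Diamond q$, and closed under modus ponens, substitution, and the rule $\varphi\to\psi\,/\,\Diamond\varphi\to\Diamond\psi$. $\mathrm K$ is the smallest logic; $\Lambda+\varphi$ is the smallest logic containing $\Lambda$ and $\varphi$; for a rule $\mathsf R$, $\Lambda+\mathsf R$ is the closure of the logic $\Lambda$ under $\mathsf R$, i.e. the smallest logic containing $\Lambda$ and closed under $\mathsf R$ (applied to all formulas $\varphi$). A logic $\Lambda$ is $n$-transitive if it contains $\Diamond^{n+1}p\to\bigvee_{k=1}^n\Diamond^kp$. (Both logics $\mathrm{K4}_{\Diamond\beta}$ and $\mathrm{wK4}_{\Diamond\beta}$ are $n$-transitive for $n=d(\beta)+1$, where $d$ is modal depth, so such $n$ exist.) A formula is strictly positive (in $p$) if it is built from the variable $p$ and the constant $\top$ using only $\wedge$ and $\Diamond$. For such formulas let $D_p(p)=\{0\}$, $D_p(\top)=\emptyset$, $D_p(\alpha_1\wedge\alpha_2)=D_p(\alpha_1)\cup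 D_p(\alpha_2)$, $D_p(\Diamond\alpha)=\{k+1\mid k\in D_p(\alpha)\}$, and $\underline d_p(\alpha):=\min(D_p(\alpha)\cup\{\infty\})$. $\mathrm{K4}_{\Diamond\beta}:=\mathrm K+(\Diamond\beta\to\Diamond p)$; $\mathrm{wK4}_{\Diamond\beta}:=\mathrm K+(\Diamond\beta\to\Diamond p\vee p)$; $\mathrm{GL}_{\Diamond\beta}:=\mathrm K+\bigl(\Diamond p\to\Diamond(p\wedge\neg\beta)\bigr)$. *)

theory Defs
  imports Main "HOL-Library.Extended_Nat"
begin

datatype fm =
    Var nat
  | Bot ("\<^bold>\<bottom>")
  | Imp fm fm (infixr "\<^bold>\<rightarrow>" 60)
  | Dia fm ("\<diamond> _" [85] 85)

abbreviation Neg :: "fm \<Rightarrow> fm" ("\<^bold>\<not> _" [85] 85)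
  where "\<^bold>\<not> \<phi> \<equiv> \<phi> \<^bold>\<rightarrow> \<^bold>\<bottom>"

abbreviation Top :: fm ("\<^bold>\<top>")
  where "\<^bold>\<top> \<equiv> \<^bold>\<not> \<^bold>\<bottom>"

abbreviation Or :: "fm \<Rightarrow> fm \<Rightarrow> fm" (infixr "\<^bold>\<or>" 70)
  where "\<phi> \<^bold>\<or> \<psi> \<equiv> \<^bold>\<not> \<phi> \<^bold>\<rightarrow> \<psi>"

abbreviation And :: "fm \<Rightarrow> fm \<Rightarrow> fm" (infixr "\<^bold>\<and>" 75)
  where "\<phi> \<^bold>\<and> \<psi> \<equiv> \<^bold>\<not> (\<phi> \<^bold>\<rightarrow> \<^bold>\<not> \<psi>)"

abbreviation Box :: "fm \<Rightarrow> fm" ("\<box> _" [85] 85)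
  where "\<box> \<phi> \<equiv> \<^bold>\<not> \<diamond> \<^bold>\<not> \<phi>"

fun disj_list :: "fm list \<Rightarrow> fm" where
  "disj_list [] = \<^bold>\<bottom>"
| "disj_list [\<phi>] = \<phi>"
| "disj_list (\<phi> # \<phi>s) = \<phi> \<^bold>\<or> disj_list \<phi>s"

fun conj_list :: "fm list \<Rightarrow> fm" where
  "conj_list [] = \<^bold>\<top>"
| "conj_list [\<phi>] = \<phi>"
| "conj_list (\<phi> # \<phi>s) = \<phi> \<^bold>\<and> conj_list \<phi>s"

definition dia_pow :: "nat \<Rightarrow> fm \<Rightarrow> fm"
  where "dia_pow k \<phi> = (Dia ^^ k) \<phi>"

definition box_pow :: "nat \<Rightarrow> fm \<Rightarrow> fm"
  where "box_pow k \<phi> = \<^bold>\<not> dia_pow k (\<^bold>\<not> \<phi>)"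

definition dia_plus :: "nat \<Rightarrow> fm \<Rightarrow> fm"
  where "dia_plus n \<phi> = disj_list (map (\<lambda>k. dia_pow k \<phi>) [1..<Suc n])"

definition box_plus :: "nat \<Rightarrow> fm \<Rightarrow> fm"
  where "box_plus n \<phi> = conj_list (map (\<lambda>k. box_pow k \<phi>) [1..<Suc n])"

primrec vars :: "fm \<Rightarrow> nat set" where
  "vars (Var x) = {x}"
| "vars \<^bold>\<bottom> = {}"
| "vars (\<phi> \<^bold>\<rightarrow> \<psi>) = vars \<phi> \<union> vars \<psi>"
| "vars (\<diamond> \<phi>) = vars \<phi>"

primrec subst :: "(nat \<Rightarrow> fm) \<Rightarrow> fm \<Rightarrow> fm" where
  "subst \<sigma> (Var x) = \<sigma> x"
| "subst \<sigma> \<^bold>\<bottom> = \<^bold>\<bottom>"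
| "subst \<sigma> (\<phi> \<^bold>\<rightarrow> \<psi>) = subst \<sigma> \<phi> \<^bold>\<rightarrow> subst \<sigma> \<psi>"
| "subst \<sigma> (\<diamond> \<phi>) = \<diamond> subst \<sigma> \<phi>"

text \<open>Boolean evaluation in which variables and formulas of the form \<open>\<diamond> \<phi>\<close> are both treated as
  atoms. The resulting tautologies are the substitution instances of the modality-free ones, so
  in a set closed under substitution it makes no difference which of the two is required.\<close>

primrec eval :: "(fm \<Rightarrow> bool) \<Rightarrow> fm \<Rightarrow> bool" where
  "eval v (Var x) \<longleftrightarrow> v (Var x)"
| "eval v \<^bold>\<bottom> \<longleftrightarrow> False"
| "eval v (\<phi> \<^bold>\<rightarrow> \<psi>) \<longleftrightarrow> (eval v \<phi> \<longrightarrow> eval v \<psi>)"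
| "eval v (\<diamond> \<phi>) \<longleftrightarrow> v (\<diamond> \<phi>)"

definition tautology :: "fm \<Rightarrow> bool"
  where "tautology \<phi> \<longleftrightarrow> (\<forall>v. eval v \<phi>)"

definition is_logic :: "fm set \<Rightarrow> bool" where
  "is_logic L \<longleftrightarrow>
     (\<forall>\<phi>. tautology \<phi> \<longrightarrow> \<phi> \<in> L) \<and>
     \<diamond> \<^bold>\<bottom> \<^bold>\<rightarrow> \<^bold>\<bottom> \<in> L \<and>
     \<diamond> (Var 0 \<^bold>\<or> Var 1) \<^bold>\<rightarrow> \<diamond> Var 0 \<^bold>\<or> \<diamond> Var 1 \<in> L \<and>
     (\<forall>\<phi> \<psi>. \<phi> \<^bold>\<rightarrow> \<psi> \<in> L \<longrightarrow> \<phi> \<in> L \<longrightarrow> \<psi> \<in> L) \<and>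
     (\<forall>\<sigma> \<phi>. \<phi> \<in> L \<longrightarrow> subst \<sigma> \<phi> \<in> L) \<and>
     (\<forall>\<phi> \<psi>. \<phi> \<^bold>\<rightarrow> \<psi> \<in> L \<longrightarrow> \<diamond> \<phi> \<^bold>\<rightarrow> \<diamond> \<psi> \<in> L)"

definition logic_K :: "fm set"
  where "logic_K = \<Inter> {L. is_logic L}"

definition add_axiom :: "fm set \<Rightarrow> fm \<Rightarrow> fm set"
  where "add_axiom \<Lambda> \<phi> = \<Inter> {L. is_logic L \<and> \<Lambda> \<subseteq> L \<and> \<phi> \<in> L}"

text \<open>A rule is given by the set of all its (premise, conclusion) instances.\<close>

definition add_rule :: "fm set \<Rightarrow> (fm \<times> fm) set \<Rightarrow> fm set"
  where "add_rule \<Lambda> R =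
    \<Inter> {L. is_logic L \<and> \<Lambda> \<subseteq> L \<and> (\<forall>(\<phi>, \<psi>) \<in> R. \<phi> \<in> L \<longrightarrow> \<psi> \<in> L)}"

definition transitive_logic :: "nat \<Rightarrow> fm set \<Rightarrow> bool"
  where "transitive_logic n \<Lambda> \<longleftrightarrow> dia_pow (n + 1) (Var 0) \<^bold>\<rightarrow> dia_plus n (Var 0) \<in> \<Lambda>"

text \<open>Strictly positive formulas in one variable. They form a separate datatype because \<open>D\<^sub>p\<close> is
  defined by recursion on \<open>\<top>\<close> and \<open>\<and>\<close>, which are not primitive in \<^typ>\<open>fm\<close>; the variable itself
  is supplied by the translation \<open>sp_fm p\<close>.\<close>

datatype sp = SP_Var | SP_Top | SP_And sp sp | SP_Dia sp

primrec sp_fm :: "nat \<Rightarrow> sp \<Rightarrow> fm" where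
  "sp_fm p SP_Var = Var p"
| "sp_fm p SP_Top = \<^bold>\<top>"
| "sp_fm p (SP_And \<alpha> \<beta>) = sp_fm p \<alpha> \<^bold>\<and> sp_fm p \<beta>"
| "sp_fm p (SP_Dia \<alpha>) = \<diamond> sp_fm p \<alpha>"

primrec depths :: "sp \<Rightarrow> nat set" where
  "depths SP_Var = {0}"
| "depths SP_Top = {}"
| "depths (SP_And \<alpha> \<beta>) = depths \<alpha> \<union> depths \<beta>"
| "depths (SP_Dia \<alpha>) = {k + 1 | k. k \<in> depths \<alpha>}"

definition min_depth :: "sp \<Rightarrow> enat"
  where "min_depth \<alpha> = Min (enat ` depths \<alpha> \<union> {\<infinity>})"

definition K4_dia :: "nat \<Rightarrow> fm \<Rightarrow> fm set"
  where "K4_dia p \<beta> = add_axiom logic_K (\<diamond> \<beta> \<^bold>\<rightarrow> \<diamond> Var p)"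

definition wK4_dia :: "nat \<Rightarrow> fm \<Rightarrow> fm set"
  where "wK4_dia p \<beta> = add_axiom logic_K (\<diamond> \<beta> \<^bold>\<rightarrow> \<diamond> Var p \<^bold>\<or> Var p)"

definition GL_dia :: "nat \<Rightarrow> fm \<Rightarrow> fm set"
  where "GL_dia p \<beta> = add_axiom logic_K (\<diamond> Var p \<^bold>\<rightarrow> \<diamond> (Var p \<^bold>\<and> \<^bold>\<not> \<beta>))"

end

theory Submission
  imports Defs
begin

text \<open>The four extensions coincide because, in an \<open>n\<close>-transitive logic, each of the two axioms and
  each of the two rules says that every nonempty definable set of worlds of the canonical model has
  a point that sees no other point of the set along the transitive closure of accessibility. That
  \<open>GL\<close> has this property and contains \<open>\<diamond> \<beta> \<rightarrow> \<diamond> p\<close> is the classical argument.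

  The converse, that \<open>\<diamond> p \<rightarrow> \<diamond> (p \<and> \<not> \<beta>)\<close> follows from \<open>\<diamond> \<beta> \<rightarrow> \<diamond> p \<or> p\<close> and maximal points, works in
  general frames. If \<open>x\<close> were a maximal counterexample for a set \<open>X\<close>, then \<open>x\<close> would see no
  point of \<open>X\<close> at which \<open>\<beta>\<close> fails, hence by weak transitivity no point with a \<open>\<beta>\<close>-tree ending in
  such points, and so on: no point of \<open>X\<close> of finite rank. So it suffices that all points of \<open>X\<close> have
  a rank below a uniform bound. Call a point critical at level \<open>r\<close> if it sees some subformula of \<open>\<beta>\<close>
  realised at rank \<open>r + 1\<close> but at no smaller rank. Given a critical point \<open>x\<close> at a high level, walk
  from a successor of \<open>x\<close>, only through points that realise, within a window of ranks, subformulas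
  that \<open>x\<close> does not see realised in that window. A walk as long as the depth of \<open>\<beta>\<close> would give a
  \<open>\<beta>\<close>-tree and contradict weak transitivity; so the walk gets stuck at a point \<open>v\<close> which, in a
  smaller window, sees fewer subformulas realised than \<open>x\<close>, since it misses the one
  it is critical for. Hence the number of visible subformulas drops, which can happen only
  finitely often.\<close>

section \<open>General frames\<close>

text \<open>Only arguments of diamonds are collected, not all subformulas: these are what a point
  can see at its successors, and their number bounds the induction in
  \<open>no_crit\<close>.\<close>

primrec bodies :: "sp \<Rightarrow> sp set" where
  "bodies SP_Var = {}"
| "bodies SP_Top = {}"
| "bodies (SP_And s t) = bodies s \<union> bodies t"
| "bodies (SP_Dia t) = insert t (bodies t)"

primrec modal_depth :: "sp \<Rightarrow> nat" where
  "modal_depth SP_Var = 0"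
| "modal_depth SP_Top = 0"
| "modal_depth (SP_And s t) = max (modal_depth s) (modal_depth t)"
| "modal_depth (SP_Dia t) = Suc (modal_depth t)"

lemma finite_bodies: "finite (bodies t)"
  by (induction t) auto

lemma bodies_trans: "s \<in> bodies t \<Longrightarrow> bodies s \<subseteq> bodies t"
  by (induction t) auto

locale general_frame =
  fixes W :: "'w set" and R :: "'w \<Rightarrow> 'w \<Rightarrow> bool" and D :: "'w set set"
  assumes R_W: "R x y \<Longrightarrow> x \<in> W \<and> y \<in> W"
    and D_W: "X \<in> D \<Longrightarrow> X \<subseteq> W"
    and D_top: "W \<in> D"
    and D_diff: "X \<in> D \<Longrightarrow> Y \<in> D \<Longrightarrow> X - Y \<in> D"
    and D_dia: "X \<in> D \<Longrightarrow> {w. \<exists>v\<in>X. R w v} \<in> D"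
begin

definition dia :: "'w set \<Rightarrow> 'w set"
  where "dia X = {w. \<exists>v\<in>X. R w v}"

lemma dia_iff: "w \<in> dia X \<longleftrightarrow> (\<exists>v\<in>X. R w v)"
  by (simp add: dia_def)

lemma dia_D: "X \<in> D \<Longrightarrow> dia X \<in> D"
  unfolding dia_def by (rule D_dia)

lemma D_empty: "{} \<in> D"
  using D_diff[OF D_top D_top] by simp

lemma D_Int: "X \<in> D \<Longrightarrow> Y \<in> D \<Longrightarrow> X \<inter> Y \<in> D"
  using D_diff[of X "X - Y"] D_diff[of X Y] by (simp add: Diff_Diff_Int)

lemma D_Un: assumes "X \<in> D" "Y \<in> D" shows "X \<union> Y \<in> D"
proof -
  have "X \<union> Y = W - ((W - X) \<inter> (W - Y))"
    using D_W assms by blast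
  then show ?thesis
    using assms D_diff D_Int D_top by metis
qed

lemma D_UN: "finite I \<Longrightarrow> (\<And>i. i \<in> I \<Longrightarrow> f i \<in> D) \<Longrightarrow> (\<Union>i\<in>I. f i) \<in> D"
  by (induction I rule: finite_induct) (auto intro: D_empty D_Un)

text \<open>\<open>ev f Y t\<close> interprets only the part of \<open>t\<close> outside all diamonds: \<open>f s\<close> is the value of \<open>\<diamond> s\<close>.\<close>

primrec ev :: "(sp \<Rightarrow> 'w set) \<Rightarrow> 'w set \<Rightarrow> sp \<Rightarrow> 'w set" where
  "ev f Y SP_Var = Y"
| "ev f Y SP_Top = W"
| "ev f Y (SP_And s t) = ev f Y s \<inter> ev f Y t"
| "ev f Y (SP_Dia t) = f t"

primrec den :: "'w set \<Rightarrow> sp \<Rightarrow> 'w set" where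
  "den Y SP_Var = Y"
| "den Y SP_Top = W"
| "den Y (SP_And s t) = den Y s \<inter> den Y t"
| "den Y (SP_Dia t) = dia (den Y t)"

lemma ev_D: "(\<And>s. f s \<in> D) \<Longrightarrow> Y \<in> D \<Longrightarrow> ev f Y t \<in> D"
  by (induction t) (auto intro: D_Int D_top)

lemma den_D: "Y \<in> D \<Longrightarrow> den Y t \<in> D"
  by (induction t) (auto intro: D_Int D_top dia_D)

text \<open>Stated at a single point \<open>w\<close>, because later arguments compare only what one
  fixed point sees; no inclusion between \<open>f\<close> and \<open>g\<close> as a whole is
  available there.\<close>

lemma ev_mono:
  "w \<in> ev f Y t \<Longrightarrow> (\<And>s. s \<in> bodies t \<Longrightarrow> w \<in> f s \<Longrightarrow> w \<in> g s) \<Longrightarrow> (w \<in> Y \<Longrightarrow> w \<in> Z) \<Longrightarrow>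
    w \<in> ev g Z t"
  by (induction t) auto

lemma den_ev: "den Y t = ev (\<lambda>s. dia (den Y s)) Y t"
  by (induction t) auto

lemma ev_modalized: "0 \<notin> depths t \<Longrightarrow> ev f Y t = ev f Z t"
  by (induction t) auto

lemma den_mono: "Y \<subseteq> Z \<Longrightarrow> den Y t \<subseteq> den Z t"
  by (induction t) (auto simp: dia_def)

lemma den_if_serial: "Y \<subseteq> W \<Longrightarrow> Y \<subseteq> dia Y \<Longrightarrow> Y \<subseteq> den Y t"
  by (induction t) (auto simp: dia_iff subset_iff, blast)

primrec path :: "'w set \<Rightarrow> nat \<Rightarrow> 'w set" where
  "path q 0 = W"
| "path q (Suc l) = dia (q \<inter> path q l)"

text \<open>All branches of \<open>t\<close> are folded onto one walk. This works because every
  point of the walk after the first lies in \<open>q\<close>; the first has to lie in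
  \<open>q\<close> only if the variable occurs outside all diamonds.\<close>

lemma path_den:
  "v \<in> path q l \<Longrightarrow> v \<in> W \<Longrightarrow> modal_depth t \<le> l \<Longrightarrow> (0 \<in> depths t \<Longrightarrow> v \<in> q) \<Longrightarrow> v \<in> den q t"
proof (induction t arbitrary: v l)
  case (SP_Dia t)
  then obtain l' where l: "l = Suc l'" by (cases l) auto
  with SP_Dia.prems obtain u where "R v u" "u \<in> q" "u \<in> path q l'"
    by (auto simp: dia_def)
  moreover have "u \<in> den q t"
    using SP_Dia.IH[of u l'] SP_Dia.prems calculation l R_W by auto
  ultimately show ?case by (auto simp: dia_def)
qed auto

end

section \<open>Frames with maximal points: ranks and their uniform bound\<close>

locale loeb_frame = general_frame +
  fixes \<alpha> :: sp
  assumes modalized: "0 \<notin> depths \<alpha>"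
    and weak_trans: "X \<in> D \<Longrightarrow> dia (den X \<alpha>) \<subseteq> dia X \<union> X"
    and loeb: "X \<in> D \<Longrightarrow> X \<noteq> {} \<Longrightarrow> \<exists>x\<in>X. \<forall>y. R\<^sup>+\<^sup>+ x y \<longrightarrow> y \<notin> X"
begin

context
  fixes X :: "'a set"
  assumes X_D: "X \<in> D"
begin

text \<open>Finite approximations from below to the solution of
  \<open>P = X \<inter> (- den X \<alpha> \<union> den P \<alpha>)\<close>; the index drops by one with every diamond.\<close>

definition P_of :: "(sp \<Rightarrow> 'a set) \<Rightarrow> 'a set"
  where "P_of f = X \<inter> ((W - den X \<alpha>) \<union> ev (\<lambda>s. dia (f s)) {} \<alpha>)"

primrec T :: "nat \<Rightarrow> sp \<Rightarrow> 'a set" where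
  "T 0 = (\<lambda>t. {})"
| "T (Suc k) = (\<lambda>t. ev (\<lambda>s. dia (T k s)) (P_of (T k)) t)"

text \<open>The rank of a realisation is the least index of \<open>T\<close> that contains it. The
  difference is taken outside \<open>dia\<close>: a critical point sees no earlier realisation at
  all.\<close>

definition crit :: "nat \<Rightarrow> 'a set"
  where "crit k = (\<Union>\<delta>\<in>bodies \<alpha>. dia (T (Suc k) \<delta>) - dia (T k \<delta>))"

lemma P_of_mono:
  assumes "w \<in> P_of f" "\<And>s. s \<in> bodies \<alpha> \<Longrightarrow> w \<in> dia (f s) \<Longrightarrow> w \<in> dia (g s)"
  shows "w \<in> P_of g"
  using assms ev_mono[of w "\<lambda>s. dia (f s)" "{}" \<alpha> "\<lambda>s. dia (g s)" "{}"]
  unfolding P_of_def by blast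

lemma T_D: "T k t \<in> D"
proof (induction k arbitrary: t)
  case (Suc k)
  then show ?case
    unfolding T.simps P_of_def
    by (intro ev_D D_Int D_Un X_D D_diff D_top den_D dia_D D_empty)
qed (simp add: D_empty)

lemma T_step: "T k t \<subseteq> T (Suc k) t"
proof (induction k arbitrary: t)
  case (Suc k)
  have dia: "dia (T k s) \<subseteq> dia (T (Suc k) s)" for s
    using Suc.IH by (auto simp: dia_def simp del: T.simps)
  show ?case
  proof
    fix w assume "w \<in> T (Suc k) t"
    then have "w \<in> ev (\<lambda>s. dia (T k s)) (P_of (T k)) t" by simp
    then have "w \<in> ev (\<lambda>s. dia (T (Suc k) s)) (P_of (T (Suc k))) t"
      by (rule ev_mono) (use dia P_of_mono in blast)+
    then show "w \<in> T (Suc (Suc k)) t" by simp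
  qed
qed simp

lemma T_mono: "k \<le> l \<Longrightarrow> T k t \<subseteq> T l t"
  by (rule lift_Suc_mono_le[of "\<lambda>k. T k t"]) (use T_step in auto)

text \<open>The value of \<open>T\<close> at \<open>w\<close> depends only on which bodies
  \<open>w\<close> sees in the previous approximation. If \<open>w\<close> is not critical, these
  are the same at both levels, so the value cannot change.\<close>

lemma exact_crit:
  assumes "\<gamma> \<in> bodies \<alpha>" "w \<in> T (Suc (Suc k)) \<gamma>" "w \<notin> T (Suc k) \<gamma>"
  shows "w \<in> crit k"
proof (rule ccontr)
  assume "w \<notin> crit k"
  then have dia: "\<And>s. s \<in> bodies \<alpha> \<Longrightarrow> w \<in> dia (T (Suc k) s) \<Longrightarrow> w \<in> dia (T k s)"
    unfolding crit_def by blast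
  have "w \<in> ev (\<lambda>s. dia (T (Suc k) s)) (P_of (T (Suc k))) \<gamma>"
    using assms(2) by simp
  then have "w \<in> ev (\<lambda>s. dia (T k s)) (P_of (T k)) \<gamma>"
    by (rule ev_mono) (use dia P_of_mono bodies_trans[OF assms(1)] in blast)+
  then show False using assms(3) by simp
qed

lemma rank_crit:
  assumes "\<gamma> \<in> bodies \<alpha>" "w \<in> T k \<gamma>" "w \<notin> T c \<gamma>" "1 \<le> c"
  shows "\<exists>r. r < k \<and> c \<le> Suc r \<and> w \<in> crit r"
proof -
  define r where "r = (LEAST r. w \<in> T r \<gamma>)"
  have r: "w \<in> T r \<gamma>" "r \<le> k" and below: "\<And>i. i < r \<Longrightarrow> w \<notin> T i \<gamma>"
    unfolding r_def using assms(2) by (auto intro: LeastI Least_le dest: not_less_Least)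
  have "c < r"
    using r(1) assms(3) T_mono[of r c \<gamma>] by (meson not_le subsetD)
  \<comment> \<open>Since \<open>1 \<le> c < r\<close>, the least rank is at least 2, as
    \<open>exact_crit\<close> requires.\<close>
  then obtain i where i: "r = Suc (Suc i)"
    using assms(4) by (metis Suc_le_D less_iff_Suc_add One_nat_def add_Suc)
  have "w \<in> crit i"
    using exact_crit[OF assms(1)] r(1) below[of "Suc i"] i by blast
  then show ?thesis using i r(2) \<open>c < r\<close> by (intro exI[of _ i]) auto
qed

text \<open>The window width needed for sets \<open>S\<close> with fewer than \<open>m\<close>
  elements: a walk of \<open>modal_depth \<alpha>\<close> steps, each costing one level plus the
  width \<open>gap m\<close> of the window to which the induction hypothesis is applied.\<close>

primrec gap :: "nat \<Rightarrow> nat" where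
  "gap 0 = 0"
| "gap (Suc m) = modal_depth \<alpha> * Suc (gap m)"

lemma crit_D: "crit k \<in> D"
  unfolding crit_def by (intro D_UN finite_bodies D_diff dia_D T_D)

text \<open>\<open>S\<close> contains the subformulas that a critical point sees at ranks in the window from \<open>j\<close> to
  \<open>k\<close>. The set \<open>Q\<close> of counterexamples is removed from \<open>q\<close> to exclude the disjunct \<open>x \<in> q\<close> of
  weak transitivity.\<close>

lemma no_crit:
  assumes "S \<subseteq> bodies \<alpha>" "card S < m" "1 \<le> j" "j + gap m \<le> k"
  shows "crit k \<subseteq> (\<Union>\<gamma>\<in>bodies \<alpha> - S. dia (T k \<gamma> - T j \<gamma>))"
  using assms
proof (induction m arbitrary: S j k)
  case (Suc m)
  note IH = Suc.IH
  define Q where "Q = crit k - (\<Union>\<gamma>\<in>bodies \<alpha> - S. dia (T k \<gamma> - T j \<gamma>))"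
  define q where "q = (\<Union>\<gamma>\<in>bodies \<alpha> - S. T k \<gamma> - T j \<gamma>) - Q"
  have Q_D: "Q \<in> D"
    unfolding Q_def by (intro D_diff crit_D D_UN finite_Diff finite_bodies dia_D T_D)
  then have q_D: "q \<in> D"
    unfolding q_def by (intro D_diff D_UN finite_Diff finite_bodies T_D)
  have "Q = {}"
  proof (rule ccontr)
    assume "Q \<noteq> {}"
    then obtain x where x: "x \<in> Q" and x_max: "\<And>y. R\<^sup>+\<^sup>+ x y \<Longrightarrow> y \<notin> Q"
      using loeb[OF Q_D] by blast
    \<comment> \<open>The walk continues as long as the level stays high enough: each step lowers
      the guaranteed level by \<open>Suc (gap m)\<close>. Maximality of \<open>x\<close> keeps the
      visited points out of \<open>Q\<close>.\<close>
    have walk: "v \<in> path q l"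
      if "R\<^sup>+\<^sup>+ x v" "v \<in> crit r" "r < k" "j + l * Suc (gap m) \<le> Suc r" for v r l
      using that
    proof (induction l arbitrary: v r)
      case 0
      then show ?case using D_W[OF crit_D] by auto
    next
      case (Suc l)
      define c where "c = j + l * Suc (gap m)"
      have cr: "c + gap m \<le> r" "j \<le> c"
        using Suc.prems(4) by (auto simp: c_def)
      show ?case
      proof (cases "\<exists>\<gamma>\<in>bodies \<alpha> - S. v \<in> dia (T k \<gamma> - T c \<gamma>)")
        case True
        then obtain \<gamma> u where u: "\<gamma> \<in> bodies \<alpha>" "\<gamma> \<notin> S" "u \<in> T k \<gamma>" "u \<notin> T c \<gamma>" "R v u"
          by (auto simp: dia_def)
        have xu: "R\<^sup>+\<^sup>+ x u" using Suc.prems(1) u(5) by simp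
        have "u \<in> q"
          using u T_mono[OF cr(2)] x_max[OF xu] unfolding q_def by blast
        moreover obtain i where "i < k" "c \<le> Suc i" "u \<in> crit i"
          using rank_crit[OF u(1,3,4)] cr(2) \<open>1 \<le> j\<close> by auto
        then have "u \<in> path q l"
          using Suc.IH[OF xu] by (auto simp: c_def)
        ultimately show ?thesis
          using u(5) by (auto simp: dia_def)
      next
        case False
        obtain \<delta> where \<delta>: "\<delta> \<in> bodies \<alpha>" "v \<in> dia (T (Suc r) \<delta>)" "v \<notin> dia (T r \<delta>)"
          using Suc.prems(2) unfolding crit_def by blast
        then obtain u where u: "R v u" "u \<in> T (Suc r) \<delta>" "u \<notin> T r \<delta>"
          unfolding dia_iff by blast
        have "u \<in> T k \<delta>" "u \<notin> T c \<delta>"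
          using T_mono[of "Suc r" k \<delta>] T_mono[of c r \<delta>] u cr(1) Suc.prems(3) by auto
        then have "\<delta> \<in> S"
          using False u(1) \<delta>(1) unfolding dia_iff by blast
        \<comment> \<open>If the walk is stuck at \<open>v\<close>, the body \<open>\<delta>\<close>
          for which \<open>v\<close> is critical belongs to \<open>S\<close>. The outer induction
          hypothesis then applies to \<open>S - {\<delta>}\<close> in the smaller window from
          \<open>c\<close> to \<open>r\<close>.\<close>
        then have "card (S - {\<delta>}) < m"
          using \<open>card S < Suc m\<close> \<open>S \<subseteq> bodies \<alpha>\<close> finite_bodies
          by (metis card_Diff1_less finite_subset less_Suc_eq_le order_less_le_trans)
        then have "v \<in> (\<Union>\<gamma>\<in>bodies \<alpha> - (S - {\<delta>}). dia (T r \<gamma> - T c \<gamma>))"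
          using IH[of "S - {\<delta>}" c r]
            Suc.prems(2) cr \<open>1 \<le> j\<close> \<open>S \<subseteq> bodies \<alpha>\<close> by auto
        then obtain \<gamma> where \<gamma>: "\<gamma> \<in> bodies \<alpha>" "\<gamma> = \<delta> \<or> \<gamma> \<notin> S" "v \<in> dia (T r \<gamma> - T c \<gamma>)"
          by blast
        \<comment> \<open>The case \<open>\<gamma> = \<delta>\<close> is excluded, as
          \<open>v\<close> sees no realisation of \<open>\<delta>\<close> in
          \<open>T r\<close>.\<close>
        then have "\<gamma> \<notin> S" "v \<in> dia (T k \<gamma> - T c \<gamma>)"
          using \<delta>(3) T_mono[of r k \<gamma>] Suc.prems(3) unfolding dia_iff by auto
        then show ?thesis using False \<gamma>(1) by blast
      qed
    qed
    obtain k' where k': "k = Suc k'"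
      using Suc.prems(3,4) by (cases k) auto
    obtain \<delta> where \<delta>: "\<delta> \<in> bodies \<alpha>" "x \<in> dia (T (Suc k) \<delta>)" "x \<notin> dia (T k \<delta>)"
      using x unfolding Q_def crit_def by blast
    then obtain z where z: "R x z" "z \<in> T (Suc k) \<delta>" "z \<notin> T k \<delta>"
      unfolding dia_iff by blast
    then have "z \<in> crit k'"
      using exact_crit[OF \<delta>(1)] k' by blast
    \<comment> \<open>The hypothesis \<open>j + gap (Suc m) \<le> k\<close> leaves room for a full
      walk of \<open>modal_depth \<alpha>\<close> steps, starting at level
      \<open>k - 1\<close>.\<close>
    then have "z \<in> path q (modal_depth \<alpha>)"
      using walk[of z k' "modal_depth \<alpha>"] z(1) k' Suc.prems(4) by auto
    then have "z \<in> den q \<alpha>"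
      using path_den modalized z(1) R_W by blast
    then have "x \<in> dia (den q \<alpha>)"
      using z(1) unfolding dia_iff by blast
    then have "x \<in> dia q \<union> q"
      using weak_trans[OF q_D] by blast
    moreover have "x \<notin> q"
      using x by (auto simp: q_def)
    ultimately obtain u where "R x u" "u \<in> q"
      by (auto simp: dia_iff)
    then obtain \<gamma> where "\<gamma> \<in> bodies \<alpha> - S" "x \<in> dia (T k \<gamma> - T j \<gamma>)"
      unfolding q_def dia_iff by blast
    then show False
      using x unfolding Q_def by blast
  qed
  then show ?case unfolding Q_def by blast
qed simp

text \<open>Unfolds an approximation into a genuine tree whose leaves lie in \<open>Y\<close>. Only
  points reachable from \<open>x\<close> are visited, so the hypothesis on \<open>Y\<close> is
  restricted to them.\<close>

lemma T_reach:
  assumes "v \<in> T k t" "R\<^sup>+\<^sup>+ x v" "\<And>u i. R\<^sup>+\<^sup>+ x u \<Longrightarrow> i < k \<Longrightarrow> u \<in> P_of (T i) \<Longrightarrow> u \<in> Y"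
  shows "v \<in> den Y t"
  using assms
proof (induction k arbitrary: v t)
  case (Suc k)
  have "v \<in> ev (\<lambda>s. dia (T k s)) (P_of (T k)) t"
    using Suc.prems(1) by simp
  then have "v \<in> ev (\<lambda>s. dia (den Y s)) Y t"
  proof (rule ev_mono)
    fix s assume "v \<in> dia (T k s)"
    then obtain u where u: "R v u" "u \<in> T k s" by (auto simp: dia_iff)
    have "R\<^sup>+\<^sup>+ x u" using Suc.prems(2) u(1) by simp
    then have "u \<in> den Y s"
      using Suc.IH[OF u(2)] Suc.prems(3) less_SucI by blast
    then show "v \<in> dia (den Y s)"
      using u(1) by (auto simp: dia_iff)
  qed (use Suc.prems in blast)
  then show ?case by (simp add: den_ev[symmetric])
qed simp

theorem gl: "dia X \<subseteq> dia (X - den X \<alpha>)"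
proof -
  \<comment> \<open>With \<open>S = bodies \<alpha>\<close> the right-hand side of
    \<open>no_crit\<close> is empty, so no point is critical at level \<open>k - 1\<close> and the
    approximations of bodies are stable from \<open>k\<close> to \<open>Suc k\<close>.\<close>
  define k where "k = Suc (Suc (gap (Suc (card (bodies \<alpha>)))))"
  have "crit (k - 1) \<subseteq> {}"
    using no_crit[of "bodies \<alpha>" "Suc (card (bodies \<alpha>))" 1 "k - 1"] by (auto simp: k_def)
  then have stable: "T (Suc k) \<gamma> \<subseteq> T k \<gamma>" if "\<gamma> \<in> bodies \<alpha>" for \<gamma>
    using exact_crit[OF that, of _ "k - 1"] by (auto simp: k_def simp del: T.simps)
  \<comment> \<open>The points where \<open>T k\<close> falls short of the true value. Above a
    maximal one both agree, so the true value there enters \<open>T (Suc k)\<close> and hence, by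
    stability, \<open>T k\<close>. This is the uniqueness argument for modalized fixed
    points.\<close>
  define B where "B = (\<Union>\<gamma>\<in>bodies \<alpha>. den X \<gamma> - T k \<gamma>)"
  have B_D: "B \<in> D"
    unfolding B_def by (intro D_UN D_diff den_D T_D X_D finite_bodies)
  have in_P: "x \<in> P_of (T k)"
    if "x \<in> X" "\<And>y \<gamma>. R\<^sup>+\<^sup>+ x y \<Longrightarrow> \<gamma> \<in> bodies \<alpha> \<Longrightarrow> y \<in> den X \<gamma> \<Longrightarrow> y \<in> T k \<gamma>" for x
  proof (cases "x \<in> den X \<alpha>")
    case True
    then have "x \<in> ev (\<lambda>s. dia (den X s)) {} \<alpha>"
      using den_ev ev_modalized[OF modalized] by blast
    then have "x \<in> ev (\<lambda>s. dia (T k s)) {} \<alpha>"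
      by (rule ev_mono) (use that(2) in \<open>unfold dia_iff, blast+\<close>)
    then show ?thesis using that(1) by (simp add: P_of_def)
  next
    case False
    then show ?thesis using that(1) D_W[OF X_D] by (auto simp: P_of_def)
  qed
  have "B = {}"
  proof (rule ccontr)
    assume "B \<noteq> {}"
    then obtain x where "x \<in> B" and "\<And>y. R\<^sup>+\<^sup>+ x y \<Longrightarrow> y \<notin> B"
      using loeb[OF B_D] by blast
    then have up: "\<And>y \<gamma>. R\<^sup>+\<^sup>+ x y \<Longrightarrow> \<gamma> \<in> bodies \<alpha> \<Longrightarrow> y \<in> den X \<gamma> \<Longrightarrow> y \<in> T k \<gamma>"
      by (auto simp: B_def)
    obtain \<gamma> where \<gamma>: "\<gamma> \<in> bodies \<alpha>" "x \<in> den X \<gamma>" "x \<notin> T k \<gamma>"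
      using \<open>x \<in> B\<close> by (auto simp: B_def)
    have "x \<in> ev (\<lambda>s. dia (den X s)) X \<gamma>"
      using \<gamma>(2) den_ev by blast
    then have "x \<in> ev (\<lambda>s. dia (T k s)) (P_of (T k)) \<gamma>"
      by (rule ev_mono)
        (use up in_P bodies_trans[OF \<gamma>(1)] in \<open>unfold dia_iff, blast+\<close>)
    then have "x \<in> T (Suc k) \<gamma>" by simp
    then show False using stable[OF \<gamma>(1)] \<gamma>(3) by blast
  qed
  then have X_P: "X \<subseteq> P_of (T k)"
    using in_P unfolding B_def by blast
  \<comment> \<open>The counterexamples to the claim. A maximal one is shown to see no point of
    \<open>P_of (T i)\<close> for any \<open>i\<close>, although all of \<open>X\<close> lies in
    \<open>P_of (T k)\<close>.\<close>
  define A where "A = dia X - dia (X - den X \<alpha>)"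
  have A_D: "A \<in> D"
    unfolding A_def by (intro D_diff dia_D X_D den_D)
  have "A = {}"
  proof (rule ccontr)
    assume "A \<noteq> {}"
    then obtain x where x: "x \<in> A" and x_max: "\<And>y. R\<^sup>+\<^sup>+ x y \<Longrightarrow> y \<notin> A"
      using loeb[OF A_D] by blast
    have "w \<notin> P_of (T i)" if "R x w" for w i
      using that
    proof (induction i arbitrary: w rule: less_induct)
      case (less i)
      \<comment> \<open>Removing \<open>A\<close> rules out the disjunct \<open>x \<in> Y\<close> of
        weak transitivity. Nothing reachable from \<open>x\<close> is lost, since \<open>x\<close>
        is maximal in \<open>A\<close>.\<close>
      define Y where "Y = (\<Union>l<i. P_of (T l)) - A"
      have Y_D: "Y \<in> D"
        unfolding Y_def P_of_def
        by (intro D_diff D_UN A_D D_Int D_Un X_D D_top den_D ev_D dia_D T_D D_empty) simp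
      show ?case
      proof
        assume w: "w \<in> P_of (T i)"
        then have "w \<in> den X \<alpha>"
          using x less.prems by (auto simp: A_def dia_iff P_of_def)
        then have "w \<in> ev (\<lambda>s. dia (T i s)) {} \<alpha>"
          using w unfolding P_of_def by blast
        then have "w \<in> ev (\<lambda>s. dia (den Y s)) Y \<alpha>"
        proof (rule ev_mono)
          fix s assume "w \<in> dia (T i s)"
          then obtain u where "R w u" "u \<in> T i s" by (auto simp: dia_iff)
          moreover have "u \<in> den Y s"
            using calculation less.prems x_max
            by (intro T_reach[of u i s x Y]) (auto simp: Y_def)
          ultimately show "w \<in> dia (den Y s)" by (auto simp: dia_iff)
        qed simp
        then have "x \<in> dia (den Y \<alpha>)"
          using less.prems den_ev unfolding dia_iff by blast
        then have "x \<in> dia Y"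
          using weak_trans[OF Y_D] x by (auto simp: Y_def)
        then obtain u l where "R x u" "l < i" "u \<in> P_of (T l)"
          by (auto simp: Y_def dia_iff)
        then show False
          using less.IH by blast
      qed
    qed
    then show False
      using x X_P by (auto simp: A_def dia_iff)
  qed
  then show ?thesis unfolding A_def by blast
qed

end

end

section \<open>The canonical model of a logic\<close>

definition world :: "fm set \<Rightarrow> fm set \<Rightarrow> bool" where
  "world L w \<longleftrightarrow> L \<subseteq> w \<and> (\<forall>\<phi> \<psi>. \<phi> \<^bold>\<rightarrow> \<psi> \<in> w \<longrightarrow> \<phi> \<in> w \<longrightarrow> \<psi> \<in> w) \<and> \<^bold>\<bottom> \<notin> w \<and>
    (\<forall>\<phi>. \<phi> \<in> w \<or> \<^bold>\<not> \<phi> \<in> w)"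

definition acc :: "fm set \<Rightarrow> fm set \<Rightarrow> fm set \<Rightarrow> bool" where
  "acc L w v \<longleftrightarrow> world L w \<and> world L v \<and> (\<forall>\<phi>\<in>v. \<diamond> \<phi> \<in> w)"

definition ext :: "fm set \<Rightarrow> fm \<Rightarrow> fm set set" where
  "ext L \<phi> = {w. world L w \<and> \<phi> \<in> w}"

lemma subst_dia_pow: "subst \<sigma> (dia_pow k \<phi>) = dia_pow k (subst \<sigma> \<phi>)"
  by (induction k) (auto simp: dia_pow_def)

lemma subst_disj_list: "subst \<sigma> (disj_list \<phi>s) = disj_list (map (subst \<sigma>) \<phi>s)"
  by (induction \<phi>s rule: disj_list.induct) auto

lemma subst_dia_plus: "subst \<sigma> (dia_plus n \<phi>) = dia_plus n (subst \<sigma> \<phi>)"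
  by (simp add: dia_plus_def subst_disj_list subst_dia_pow comp_def del: upt_Suc)

primrec inst :: "fm \<Rightarrow> sp \<Rightarrow> fm" where
  "inst \<phi> SP_Var = \<phi>"
| "inst \<phi> SP_Top = \<^bold>\<top>"
| "inst \<phi> (SP_And s t) = inst \<phi> s \<^bold>\<and> inst \<phi> t"
| "inst \<phi> (SP_Dia t) = \<diamond> inst \<phi> t"

lemma sp_fm_inst: "sp_fm p t = inst (Var p) t"
  by (induction t) auto

lemma subst_sp_fm: "subst \<sigma> (sp_fm p t) = inst (\<sigma> p) t"
  by (induction t) auto

locale logic =
  fixes L :: "fm set"
  assumes is_logic: "is_logic L"
begin

lemma taut: "(\<And>v. eval v \<phi>) \<Longrightarrow> \<phi> \<in> L"
  using is_logic by (simp add: is_logic_def tautology_def)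

lemma mp: "\<phi> \<^bold>\<rightarrow> \<psi> \<in> L \<Longrightarrow> \<phi> \<in> L \<Longrightarrow> \<psi> \<in> L"
  using is_logic by (simp add: is_logic_def)

lemma mono: "\<phi> \<^bold>\<rightarrow> \<psi> \<in> L \<Longrightarrow> \<diamond> \<phi> \<^bold>\<rightarrow> \<diamond> \<psi> \<in> L"
  using is_logic by (simp add: is_logic_def)

lemma substI: "\<phi> \<in> L \<Longrightarrow> subst \<sigma> \<phi> \<in> L"
  using is_logic by (simp add: is_logic_def)

lemma dia_or: "\<diamond> (\<phi> \<^bold>\<or> \<psi>) \<^bold>\<rightarrow> \<diamond> \<phi> \<^bold>\<or> \<diamond> \<psi> \<in> L"
proof -
  have "\<diamond> (Var 0 \<^bold>\<or> Var 1) \<^bold>\<rightarrow> \<diamond> Var 0 \<^bold>\<or> \<diamond> Var 1 \<in> L"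
    using is_logic by (simp add: is_logic_def)
  from substI[OF this, of "\<lambda>x. if x = 0 then \<phi> else \<psi>"] show ?thesis by simp
qed

lemma dia_bot: "\<diamond> \<^bold>\<bottom> \<^bold>\<rightarrow> \<^bold>\<bottom> \<in> L"
  using is_logic by (simp add: is_logic_def)

lemma world_L: "world L w \<Longrightarrow> \<phi> \<in> L \<Longrightarrow> \<phi> \<in> w"
  by (auto simp: world_def)

lemma world_mp: "world L w \<Longrightarrow> \<phi> \<^bold>\<rightarrow> \<psi> \<in> w \<Longrightarrow> \<phi> \<in> w \<Longrightarrow> \<psi> \<in> w"
  by (auto simp: world_def)

lemma world_Bot [simp]: "world L w \<Longrightarrow> \<^bold>\<bottom> \<notin> w"
  by (auto simp: world_def)

lemma world_Imp [simp]: "world L w \<Longrightarrow> \<phi> \<^bold>\<rightarrow> \<psi> \<in> w \<longleftrightarrow> (\<phi> \<in> w \<longrightarrow> \<psi> \<in> w)"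
proof
  assume w: "world L w" and imp: "\<phi> \<in> w \<longrightarrow> \<psi> \<in> w"
  have "\<^bold>\<not> \<phi> \<^bold>\<rightarrow> \<phi> \<^bold>\<rightarrow> \<psi> \<in> w" "\<psi> \<^bold>\<rightarrow> \<phi> \<^bold>\<rightarrow> \<psi> \<in> w"
    by (auto intro!: world_L[OF w] taut)
  moreover have "\<^bold>\<not> \<phi> \<in> w \<or> \<psi> \<in> w"
    using w imp by (auto simp: world_def)
  ultimately show "\<phi> \<^bold>\<rightarrow> \<psi> \<in> w"
    using world_mp[OF w] by blast
qed (use world_mp in blast)

text \<open>Zorn's lemma gives a theory \<open>M\<close> maximal among those omitting
  \<open>\<xi>\<close>. By a deduction argument every formula outside \<open>M\<close> implies
  \<open>\<xi>\<close> in \<open>M\<close>; if both \<open>\<phi>\<close> and its negation were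
  outside, \<open>\<xi>\<close> would follow by cases.\<close>

lemma lindenbaum:
  assumes "L \<subseteq> \<Gamma>" "\<And>\<phi> \<psi>. \<phi> \<^bold>\<rightarrow> \<psi> \<in> \<Gamma> \<Longrightarrow> \<phi> \<in> \<Gamma> \<Longrightarrow> \<psi> \<in> \<Gamma>" "\<xi> \<notin> \<Gamma>"
  shows "\<exists>w. world L w \<and> \<Gamma> \<subseteq> w \<and> \<xi> \<notin> w"
proof -
  define \<A> where "\<A> = {\<Delta>. \<Gamma> \<subseteq> \<Delta> \<and> (\<forall>\<phi> \<psi>. \<phi> \<^bold>\<rightarrow> \<psi> \<in> \<Delta> \<longrightarrow> \<phi> \<in> \<Delta> \<longrightarrow> \<psi> \<in> \<Delta>) \<and> \<xi> \<notin> \<Delta>}"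
  have "\<exists>M\<in>\<A>. \<forall>\<Delta>\<in>\<A>. M \<subseteq> \<Delta> \<longrightarrow> \<Delta> = M"
  proof (rule subset_Zorn_nonempty)
    show "\<A> \<noteq> {}" using assms by (auto simp: \<A>_def)
  next
    fix C assume C: "C \<noteq> {}" "subset.chain \<A> C"
    then have sub: "C \<subseteq> \<A>" and lin: "\<And>X Y. X \<in> C \<Longrightarrow> Y \<in> C \<Longrightarrow> X \<subseteq> Y \<or> Y \<subseteq> X"
      by (auto simp: subset_chain_def)
    have "\<psi> \<in> \<Union>C" if imp: "\<phi> \<^bold>\<rightarrow> \<psi> \<in> \<Union>C" and \<phi>: "\<phi> \<in> \<Union>C" for \<phi> \<psi>
    proof -
      from imp \<phi> obtain X where "X \<in> C" "\<phi> \<^bold>\<rightarrow> \<psi> \<in> X" "\<phi> \<in> X"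
        using lin by (meson UnionE subsetD)
      then show ?thesis using sub unfolding \<A>_def by blast
    qed
    then show "\<Union>C \<in> \<A>" using C(1) sub unfolding \<A>_def by blast
  qed
  then obtain M where "M \<in> \<A>" and max: "\<And>\<Delta>. \<Delta> \<in> \<A> \<Longrightarrow> M \<subseteq> \<Delta> \<Longrightarrow> \<Delta> = M" by blast
  then have M: "\<Gamma> \<subseteq> M" "\<xi> \<notin> M" and mpM: "\<And>\<phi> \<psi>. \<phi> \<^bold>\<rightarrow> \<psi> \<in> M \<Longrightarrow> \<phi> \<in> M \<Longrightarrow> \<psi> \<in> M"
    unfolding \<A>_def by blast+
  have LM: "\<phi> \<in> M" if "\<And>v. eval v \<phi>" for \<phi>
    using taut[OF that] assms(1) M(1) by blast
  have imp: "\<psi> \<^bold>\<rightarrow> \<xi> \<in> M" if "\<psi> \<notin> M" for \<psi>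
  proof (rule ccontr)
    assume neg: "\<psi> \<^bold>\<rightarrow> \<xi> \<notin> M"
    define \<Delta> where "\<Delta> = {\<chi>. \<psi> \<^bold>\<rightarrow> \<chi> \<in> M}"
    have "M \<subseteq> \<Delta>"
      unfolding \<Delta>_def by (auto intro: mpM[OF LM])
    moreover have "\<chi> \<in> \<Delta>" if "\<phi> \<^bold>\<rightarrow> \<chi> \<in> \<Delta>" "\<phi> \<in> \<Delta>" for \<phi> \<chi>
      using mpM[OF mpM[OF LM[of "(\<psi> \<^bold>\<rightarrow> \<phi> \<^bold>\<rightarrow> \<chi>) \<^bold>\<rightarrow> (\<psi> \<^bold>\<rightarrow> \<phi>) \<^bold>\<rightarrow> \<psi> \<^bold>\<rightarrow> \<chi>"]]] that
      by (auto simp: \<Delta>_def)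
    ultimately have "\<Delta> \<in> \<A>"
      using M(1) neg unfolding \<A>_def by (auto simp: \<Delta>_def)
    moreover have "\<psi> \<in> \<Delta>"
      unfolding \<Delta>_def by (auto intro: LM)
    ultimately show False using max \<open>M \<subseteq> \<Delta>\<close> that by blast
  qed
  have prime: "\<phi> \<in> M \<or> \<^bold>\<not> \<phi> \<in> M" for \<phi>
  proof (rule ccontr)
    assume "\<not> ?thesis"
    then have "\<phi> \<^bold>\<rightarrow> \<xi> \<in> M" "\<^bold>\<not> \<phi> \<^bold>\<rightarrow> \<xi> \<in> M" using imp by auto
    moreover have "(\<phi> \<^bold>\<rightarrow> \<xi>) \<^bold>\<rightarrow> (\<^bold>\<not> \<phi> \<^bold>\<rightarrow> \<xi>) \<^bold>\<rightarrow> \<xi> \<in> M" by (rule LM) auto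
    ultimately show False using mpM M(2) by blast
  qed
  have "world L M"
    unfolding world_def
  proof (intro conjI allI impI)
    show "\<^bold>\<bottom> \<notin> M"
      using mpM[OF LM[of "\<^bold>\<bottom> \<^bold>\<rightarrow> \<xi>"]] M(2) by auto
  qed (use assms(1) M(1) prime in \<open>auto intro: mpM\<close>)
  then show ?thesis using M by blast
qed

lemma complete: "\<phi> \<in> L \<longleftrightarrow> (\<forall>w. world L w \<longrightarrow> \<phi> \<in> w)"
proof
  show "\<phi> \<in> L \<Longrightarrow> \<forall>w. world L w \<longrightarrow> \<phi> \<in> w"
    using world_L by blast
next
  assume "\<forall>w. world L w \<longrightarrow> \<phi> \<in> w"
  then show "\<phi> \<in> L"
    using lindenbaum[OF subset_refl, of \<phi>] mp by blast
qed

lemma acc_exists: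
  assumes w: "world L w" and dia: "\<diamond> \<phi> \<in> w"
  shows "\<exists>v. acc L w v \<and> \<phi> \<in> v"
proof -
  define \<Gamma> where "\<Gamma> = {\<chi>. \<diamond> \<^bold>\<not> (\<phi> \<^bold>\<rightarrow> \<chi>) \<notin> w}"
  have mono_w: "\<diamond> \<chi> \<in> w" if "\<And>v. eval v (\<psi> \<^bold>\<rightarrow> \<chi>)" "\<diamond> \<psi> \<in> w" for \<psi> \<chi>
    using world_L[OF w mono[OF taut]] world_mp[OF w] that by blast
  have or_w: "\<diamond> \<psi> \<in> w \<or> \<diamond> \<chi> \<in> w" if "\<diamond> (\<psi> \<^bold>\<or> \<chi>) \<in> w" for \<psi> \<chi>
    using world_L[OF w dia_or[of \<psi> \<chi>]] that w by auto
  have "L \<subseteq> \<Gamma>"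
  proof
    fix \<chi> assume "\<chi> \<in> L"
    then have "\<^bold>\<not> (\<phi> \<^bold>\<rightarrow> \<chi>) \<^bold>\<rightarrow> \<^bold>\<bottom> \<in> L"
      using mp[OF taut[of "\<chi> \<^bold>\<rightarrow> \<^bold>\<not> (\<phi> \<^bold>\<rightarrow> \<chi>) \<^bold>\<rightarrow> \<^bold>\<bottom>"]] by simp
    then show "\<chi> \<in> \<Gamma>"
      using world_L[OF w mono] world_L[OF w dia_bot] w unfolding \<Gamma>_def by fastforce
  qed
  moreover have "\<psi> \<in> \<Gamma>" if "\<chi> \<^bold>\<rightarrow> \<psi> \<in> \<Gamma>" "\<chi> \<in> \<Gamma>" for \<chi> \<psi>
    using that or_w mono_w[of "\<^bold>\<not> (\<phi> \<^bold>\<rightarrow> \<psi>)" "\<^bold>\<not> (\<phi> \<^bold>\<rightarrow> \<chi> \<^bold>\<rightarrow> \<psi>) \<^bold>\<or> \<^bold>\<not> (\<phi> \<^bold>\<rightarrow> \<chi>)"]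
    unfolding \<Gamma>_def by auto
  moreover have "\<^bold>\<bottom> \<notin> \<Gamma>"
    using mono_w[of \<phi> "\<^bold>\<not> \<^bold>\<not> \<phi>"] dia unfolding \<Gamma>_def by auto
  ultimately obtain v where v: "world L v" "\<Gamma> \<subseteq> v"
    using lindenbaum[of \<Gamma> "\<^bold>\<bottom>"] by blast
  have "\<phi> \<in> \<Gamma>"
    using mono_w[of "\<^bold>\<not> (\<phi> \<^bold>\<rightarrow> \<phi>)" "\<^bold>\<bottom>"] world_L[OF w dia_bot] w unfolding \<Gamma>_def by auto
  moreover have "\<diamond> \<chi> \<in> w" if "\<chi> \<in> v" for \<chi>
  proof (rule ccontr)
    assume "\<diamond> \<chi> \<notin> w"
    then have "\<^bold>\<not> \<chi> \<in> \<Gamma>"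
      using mono_w[of "\<^bold>\<not> (\<phi> \<^bold>\<rightarrow> \<^bold>\<not> \<chi>)" \<chi>] unfolding \<Gamma>_def by auto
    then show False using v that by auto
  qed
  ultimately show ?thesis
    using w v unfolding acc_def by blast
qed

lemma world_Dia: "world L w \<Longrightarrow> \<diamond> \<phi> \<in> w \<longleftrightarrow> (\<exists>v. acc L w v \<and> \<phi> \<in> v)"
  using acc_exists by (auto simp: acc_def)

lemma acc_world: "acc L w v \<Longrightarrow> world L w \<and> world L v"
  by (simp add: acc_def)

lemma relpowp_world: "(acc L ^^ k) w v \<Longrightarrow> world L w \<Longrightarrow> world L v"
  by (cases k) (auto simp: acc_world)

lemma tranclp_world: "(acc L)\<^sup>+\<^sup>+ w v \<Longrightarrow> world L w \<and> world L v"
  by (induction rule: tranclp_induct) (auto simp: acc_world)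

lemma world_dia_pow:
  "world L w \<Longrightarrow> dia_pow k \<phi> \<in> w \<longleftrightarrow> (\<exists>v. (acc L ^^ k) w v \<and> \<phi> \<in> v)"
proof (induction k arbitrary: w)
  case (Suc k)
  have "dia_pow (Suc k) \<phi> \<in> w \<longleftrightarrow> (\<exists>u. acc L w u \<and> dia_pow k \<phi> \<in> u)"
    using world_Dia[OF Suc.prems] by (simp add: dia_pow_def)
  also have "\<dots> \<longleftrightarrow> (\<exists>v. (acc L ^^ Suc k) w v \<and> \<phi> \<in> v)"
    using Suc.IH acc_world by (metis relpowp_Suc_D2 relpowp_Suc_I2)
  finally show ?case .
qed (simp add: dia_pow_def)

lemma world_disj_list: "world L w \<Longrightarrow> disj_list \<phi>s \<in> w \<longleftrightarrow> (\<exists>\<phi>\<in>set \<phi>s. \<phi> \<in> w)"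
  by (induction \<phi>s rule: disj_list.induct) auto

lemma world_conj_list: "world L w \<Longrightarrow> conj_list \<phi>s \<in> w \<longleftrightarrow> (\<forall>\<phi>\<in>set \<phi>s. \<phi> \<in> w)"
  by (induction \<phi>s rule: conj_list.induct) auto

lemma world_dia_plus: "world L w \<Longrightarrow> dia_plus n \<phi> \<in> w \<longleftrightarrow> (\<exists>k\<in>{1..n}. dia_pow k \<phi> \<in> w)"
  by (auto simp: dia_plus_def world_disj_list simp del: upt_Suc)

lemma world_box_plus:
  "world L w \<Longrightarrow> box_plus n \<phi> \<in> w \<longleftrightarrow> (\<forall>k\<in>{1..n}. dia_pow k (\<^bold>\<not> \<phi>) \<notin> w)"
  by (auto simp: box_plus_def box_pow_def world_conj_list simp del: upt_Suc)

text \<open>With the definable sets as admissible sets, closure of the logic under substitution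
  turns an axiom into a condition on every admissible set.\<close>

sublocale general_frame "{w. world L w}" "acc L" "range (ext L)"
proof
  show "{w. world L w} \<in> range (ext L)"
    by (rule image_eqI[of _ _ "\<^bold>\<top>"]) (auto simp: ext_def)
next
  fix X Y assume "X \<in> range (ext L)" "Y \<in> range (ext L)"
  then obtain \<phi> \<psi> where "X = ext L \<phi>" "Y = ext L \<psi>" by blast
  then show "X - Y \<in> range (ext L)"
    by (intro image_eqI[of _ _ "\<phi> \<^bold>\<and> \<^bold>\<not> \<psi>"]) (auto simp: ext_def)
next
  fix X assume "X \<in> range (ext L)"
  then obtain \<phi> where "X = ext L \<phi>" by blast
  then have "{w. \<exists>v\<in>X. acc L w v} = ext L (\<diamond> \<phi>)"
    using world_Dia acc_world unfolding ext_def by blast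
  then show "{w. \<exists>v\<in>X. acc L w v} \<in> range (ext L)"
    by blast
qed (auto simp: acc_world ext_def)

lemma ext_dia: "ext L (\<diamond> \<phi>) = dia (ext L \<phi>)"
  using world_Dia acc_world unfolding ext_def dia_def by blast

lemma ext_and: "ext L (\<phi> \<^bold>\<and> \<psi>) = ext L \<phi> \<inter> ext L \<psi>"
  by (auto simp: ext_def)

lemma ext_Top: "ext L \<^bold>\<top> = {w. world L w}"
  by (auto simp: ext_def)

lemma ext_inst: "ext L (inst \<phi> t) = den (ext L \<phi>) t"
  by (induction t) (simp_all only: inst.simps den.simps ext_and ext_Top ext_dia)

lemma imp_iff_ext: "\<phi> \<^bold>\<rightarrow> \<psi> \<in> L \<longleftrightarrow> ext L \<phi> \<subseteq> ext L \<psi>"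
  using complete by (auto simp: ext_def)

lemma ext_or: "ext L (\<phi> \<^bold>\<or> \<psi>) = ext L \<phi> \<union> ext L \<psi>"
  by (auto simp: ext_def)

lemma ext_diff: "ext L (\<phi> \<^bold>\<and> \<^bold>\<not> \<psi>) = ext L \<phi> - ext L \<psi>"
  by (auto simp: ext_def)

definition box_rule :: bool where
  "box_rule \<longleftrightarrow> (\<forall>\<phi>. \<box> \<phi> \<^bold>\<rightarrow> \<phi> \<in> L \<longrightarrow> \<phi> \<in> L)"

text \<open>Contraposition: \<open>X\<close> is the set of worlds refuting \<open>\<phi>\<close>.
  Double negation makes every definable set of this form.\<close>

lemma box_rule_iff: "box_rule \<longleftrightarrow> (\<forall>X\<in>range (ext L). X \<subseteq> dia X \<longrightarrow> X = {})"
proof -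
  have neg: "\<phi> \<in> L \<longleftrightarrow> ext L (\<^bold>\<not> \<phi>) = {}" for \<phi>
    using complete by (auto simp: ext_def)
  have imp: "\<box> \<phi> \<^bold>\<rightarrow> \<phi> \<in> L \<longleftrightarrow> ext L (\<^bold>\<not> \<phi>) \<subseteq> dia (ext L (\<^bold>\<not> \<phi>))" for \<phi>
    unfolding ext_dia[symmetric] complete by (auto simp: ext_def)
  have nn: "ext L \<phi> = ext L (\<^bold>\<not> \<^bold>\<not> \<phi>)" for \<phi>
    by (auto simp: ext_def)
  show ?thesis
    unfolding box_rule_def imp unfolding neg
  proof (intro iffI ballI impI allI)
    fix X assume all: "\<forall>\<phi>. ext L (\<^bold>\<not> \<phi>) \<subseteq> dia (ext L (\<^bold>\<not> \<phi>)) \<longrightarrow> ext L (\<^bold>\<not> \<phi>) = {}"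
      and "X \<in> range (ext L)" and sub: "X \<subseteq> dia X"
    then obtain \<phi> where "X = ext L \<phi>" by blast
    then have "X = ext L (\<^bold>\<not> \<^bold>\<not> \<phi>)" using nn[of \<phi>] by simp
    then show "X = {}" using all[rule_format, of "\<^bold>\<not> \<phi>"] sub by simp
  qed simp
qed

end

section \<open>Transitive closure and maximal points in n-transitive logics\<close>

locale pretransitive_logic = logic +
  fixes n :: nat
  assumes n: "n \<ge> 1" and trans: "transitive_logic n L"
begin

text \<open>In a walk longer than \<open>n\<close>, the first \<open>n + 1\<close> steps can be
  replaced by at most \<open>n\<close>. The endpoint may change, but \<open>\<phi>\<close> still
  holds at the new one.\<close>

lemma dia_plus_iff:
  assumes w: "world L w"
  shows "dia_plus n \<phi> \<in> w \<longleftrightarrow> (\<exists>v. (acc L)\<^sup>+\<^sup>+ w v \<and> \<phi> \<in> v)"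
proof
  assume "dia_plus n \<phi> \<in> w"
  then obtain k v where "k \<in> {1..n}" "(acc L ^^ k) w v" "\<phi> \<in> v"
    unfolding world_dia_plus[OF w] world_dia_pow[OF w] by blast
  then have "(acc L)\<^sup>+\<^sup>+ w v"
    unfolding tranclp_power by (intro exI[of _ k]) auto
  then show "\<exists>v. (acc L)\<^sup>+\<^sup>+ w v \<and> \<phi> \<in> v"
    using \<open>\<phi> \<in> v\<close> by blast
next
  have ax: "dia_pow (n + 1) \<psi> \<^bold>\<rightarrow> dia_plus n \<psi> \<in> L" for \<psi>
    using substI[OF trans[unfolded transitive_logic_def], of "\<lambda>_. \<psi>"]
    by (simp add: subst_dia_pow subst_dia_plus)
  have step: "dia_plus n \<phi> \<in> w" if "(acc L ^^ k) w v" "k > 0" "\<phi> \<in> v" for k v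
    using that
  proof (induction k arbitrary: v rule: less_induct)
    case (less k)
    show ?case
    proof (cases "k \<le> n")
      case True
      then show ?thesis
        using less.prems unfolding world_dia_plus[OF w] world_dia_pow[OF w]
        by (intro bexI[of _ k]) auto
    next
      case False
      define j where "j = k - (n + 1)"
      have k: "k = (n + 1) + j" using False by (simp add: j_def)
      then obtain u where u: "(acc L ^^ (n + 1)) w u" "(acc L ^^ j) u v"
        using less.prems(1) by (metis relcomppE relpowp_add)
      then have "dia_pow j \<phi> \<in> u"
        using relpowp_world w less.prems(3) world_dia_pow by blast
      then have "dia_pow (n + 1) (dia_pow j \<phi>) \<in> w"
        using u(1) w world_dia_pow by blast
      then have "dia_plus n (dia_pow j \<phi>) \<in> w"
        using world_mp[OF w world_L[OF w ax]] by blast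
      then obtain i where i: "i \<in> {1..n}" "dia_pow i (dia_pow j \<phi>) \<in> w"
        unfolding world_dia_plus[OF w] by blast
      then have "dia_pow (i + j) \<phi> \<in> w"
        by (simp add: dia_pow_def funpow_add)
      then obtain v' where "(acc L ^^ (i + j)) w v'" "\<phi> \<in> v'"
        using w world_dia_pow by blast
      then show ?thesis
        using less.IH[of "i + j"] i(1) k by auto
    qed
  qed
  assume "\<exists>v. (acc L)\<^sup>+\<^sup>+ w v \<and> \<phi> \<in> v"
  then show "dia_plus n \<phi> \<in> w"
    using step unfolding tranclp_power by blast
qed

definition dia_trancl :: "fm set set \<Rightarrow> fm set set"
  where "dia_trancl X = {w. \<exists>v\<in>X. (acc L)\<^sup>+\<^sup>+ w v}"

lemma dia_trancl_iff: "w \<in> dia_trancl X \<longleftrightarrow> (\<exists>v\<in>X. (acc L)\<^sup>+\<^sup>+ w v)"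
  by (simp add: dia_trancl_def)

lemma ext_dia_plus: "ext L (dia_plus n \<phi>) = dia_trancl (ext L \<phi>)"
proof (rule set_eqI)
  fix w
  have "w \<in> ext L (dia_plus n \<phi>) \<longleftrightarrow> world L w \<and> (\<exists>v. (acc L)\<^sup>+\<^sup>+ w v \<and> \<phi> \<in> v)"
    using dia_plus_iff[of w \<phi>] by (auto simp: ext_def)
  also have "\<dots> \<longleftrightarrow> (\<exists>v. (acc L)\<^sup>+\<^sup>+ w v \<and> world L v \<and> \<phi> \<in> v)"
    using tranclp_world[of w] by blast
  finally show "w \<in> ext L (dia_plus n \<phi>) \<longleftrightarrow> w \<in> dia_trancl (ext L \<phi>)"
    by (auto simp: ext_def dia_trancl_def)
qed

lemma dia_trancl_D: "X \<in> range (ext L) \<Longrightarrow> dia_trancl X \<in> range (ext L)"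
  by (auto simp: ext_dia_plus[symmetric])

lemma dia_subset_trancl: "dia X \<subseteq> dia_trancl X"
  unfolding dia_def dia_trancl_def by (blast intro: tranclp.r_into_trancl)

text \<open>Let \<open>Y\<close> be the points of \<open>X\<close> that are neither maximal nor able
  to reach a maximal one. Each reaches another point of \<open>Y\<close>, possibly in several steps,
  so the box rule is applied to \<open>dia_trancl Y\<close> instead of \<open>Y\<close>: the first
  step of a walk into \<open>Y\<close> can still be continued into \<open>Y\<close>.\<close>

lemma maximal:
  assumes "box_rule" "X \<in> range (ext L)" "x \<in> X"
  shows "\<exists>v. v \<in> X - dia_trancl X \<and> (v = x \<or> (acc L)\<^sup>+\<^sup>+ x v)"
proof -
  define M where "M = X - dia_trancl X"
  define Y where "Y = X - M - dia_trancl M"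
  have Y_D: "Y \<in> range (ext L)"
    unfolding Y_def M_def by (intro D_diff dia_trancl_D assms(2))
  have "Y \<subseteq> dia_trancl Y"
  proof
    fix y assume y: "y \<in> Y"
    then obtain v where v: "v \<in> X" "(acc L)\<^sup>+\<^sup>+ y v"
      unfolding Y_def M_def dia_trancl_def by blast
    then have "v \<notin> M" "v \<notin> dia_trancl M"
      using y tranclp_trans[OF v(2)] unfolding Y_def dia_trancl_def by blast+
    then show "y \<in> dia_trancl Y"
      using v unfolding Y_def dia_trancl_def by blast
  qed
  moreover have "dia_trancl Y \<subseteq> dia (dia_trancl Y)"
  proof
    fix w assume "w \<in> dia_trancl Y"
    then obtain v where v: "v \<in> Y" "(acc L)\<^sup>+\<^sup>+ w v"
      unfolding dia_trancl_def by blast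
    obtain v' where v': "v' \<in> Y" "(acc L)\<^sup>+\<^sup>+ v v'"
      using \<open>Y \<subseteq> dia_trancl Y\<close> v(1) unfolding dia_trancl_def by blast
    obtain u where u: "acc L w u" "(acc L)\<^sup>*\<^sup>* u v"
      using tranclpD[OF v(2)] by blast
    have "(acc L)\<^sup>+\<^sup>+ u v'"
      using rtranclp_tranclp_tranclp[OF u(2) v'(2)] .
    then show "w \<in> dia (dia_trancl Y)"
      using u(1) v'(1) unfolding dia_def dia_trancl_def by blast
  qed
  ultimately have "Y = {}"
    using \<open>box_rule\<close> dia_trancl_D[OF Y_D] unfolding box_rule_iff by blast
  then show ?thesis
    using assms(3) unfolding Y_def M_def dia_trancl_def by blast
qed

text \<open>The conclusion is a disguised emptiness claim, in the shape that both axioms yield when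
  their set of maximal points is empty.\<close>

lemma box_ruleI:
  assumes "\<And>\<phi>. ext L \<phi> \<subseteq> dia (ext L \<phi>) \<Longrightarrow> ext L \<phi> \<subseteq> dia_trancl {}"
  shows box_rule
  unfolding box_rule_iff
proof (intro ballI impI)
  fix X assume "X \<in> range (ext L)" "X \<subseteq> dia X"
  then have "X \<subseteq> dia_trancl {}" using assms by fast
  then show "X = {}" by (simp add: dia_trancl_def)
qed

lemma trancl_axiom_iff:
  "dia_plus n (Var p) \<^bold>\<rightarrow> dia_plus n (Var p \<^bold>\<and> \<^bold>\<not> dia_plus n (Var p)) \<in> L \<longleftrightarrow> box_rule"
  (is "?ax \<in> L \<longleftrightarrow> _")
proof
  assume "?ax \<in> L"
  then have "dia_plus n \<phi> \<^bold>\<rightarrow> dia_plus n (\<phi> \<^bold>\<and> \<^bold>\<not> dia_plus n \<phi>) \<in> L" for \<phi>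
    using substI[of ?ax "\<lambda>_. \<phi>"] by (simp add: subst_dia_plus)
  then have "dia_trancl (ext L \<phi>) \<subseteq> dia_trancl (ext L \<phi> - dia_trancl (ext L \<phi>))" for \<phi>
    unfolding imp_iff_ext ext_dia_plus ext_diff .
  note sub = this
  show box_rule
  proof (rule box_ruleI)
    fix \<phi> assume "ext L \<phi> \<subseteq> dia (ext L \<phi>)"
    then have "ext L \<phi> \<subseteq> dia_trancl (ext L \<phi>)" using dia_subset_trancl by blast
    moreover from this have empty: "ext L \<phi> - dia_trancl (ext L \<phi>) = {}" by blast
    ultimately show "ext L \<phi> \<subseteq> dia_trancl {}" using sub[of \<phi>, unfolded empty] by blast
  qed
next
  assume br: box_rule
  have "dia_trancl (ext L \<phi>) \<subseteq> dia_trancl (ext L \<phi> - dia_trancl (ext L \<phi>))" for \<phi>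
  proof
    fix w assume "w \<in> dia_trancl (ext L \<phi>)"
    then obtain x where x: "(acc L)\<^sup>+\<^sup>+ w x" "x \<in> ext L \<phi>"
      unfolding dia_trancl_iff by blast
    obtain v where v: "v \<in> ext L \<phi> - dia_trancl (ext L \<phi>)" "v = x \<or> (acc L)\<^sup>+\<^sup>+ x v"
      using maximal[OF br rangeI x(2)] by blast
    then have "(acc L)\<^sup>+\<^sup>+ w v"
      using x(1) by auto
    then show "w \<in> dia_trancl (ext L \<phi> - dia_trancl (ext L \<phi>))"
      using v(1) unfolding dia_trancl_iff by blast
  qed
  then show "?ax \<in> L"
    unfolding imp_iff_ext ext_dia_plus ext_diff by blast
qed

text \<open>A point that reaches no point of the set along the transitive closure has no immediate
  successor in it either, so \<open>maximal\<close> also provides the weaker witness needed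
  here.\<close>

lemma dia_axiom_iff:
  "\<diamond> Var p \<^bold>\<rightarrow> dia_plus n (Var p \<^bold>\<and> \<^bold>\<not> \<diamond> Var p) \<in> L \<longleftrightarrow> box_rule"
  (is "?ax \<in> L \<longleftrightarrow> _")
proof
  assume "?ax \<in> L"
  then have "\<diamond> \<phi> \<^bold>\<rightarrow> dia_plus n (\<phi> \<^bold>\<and> \<^bold>\<not> \<diamond> \<phi>) \<in> L" for \<phi>
    using substI[of ?ax "\<lambda>_. \<phi>"] by (simp add: subst_dia_plus)
  then have "dia (ext L \<phi>) \<subseteq> dia_trancl (ext L \<phi> - dia (ext L \<phi>))" for \<phi>
    unfolding imp_iff_ext ext_dia_plus ext_diff ext_dia .
  note sub = this
  show box_rule
  proof (rule box_ruleI)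
    fix \<phi> assume "ext L \<phi> \<subseteq> dia (ext L \<phi>)"
    moreover from this have empty: "ext L \<phi> - dia (ext L \<phi>) = {}" by blast
    ultimately show "ext L \<phi> \<subseteq> dia_trancl {}" using sub[of \<phi>, unfolded empty] by blast
  qed
next
  assume br: box_rule
  have "dia (ext L \<phi>) \<subseteq> dia_trancl (ext L \<phi> - dia (ext L \<phi>))" for \<phi>
  proof
    fix w assume "w \<in> dia (ext L \<phi>)"
    then obtain x where x: "acc L w x" "x \<in> ext L \<phi>" by (auto simp: dia_iff)
    obtain v where v: "v \<in> ext L \<phi> - dia_trancl (ext L \<phi>)" "v = x \<or> (acc L)\<^sup>+\<^sup>+ x v"
      using maximal[OF br rangeI x(2)] by blast
    then have "v \<in> ext L \<phi> - dia (ext L \<phi>)"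
      using dia_subset_trancl by blast
    moreover have "(acc L)\<^sup>+\<^sup>+ w v"
      using v(2) x(1) by (auto intro: tranclp_into_tranclp2)
    ultimately show "w \<in> dia_trancl (ext L \<phi> - dia (ext L \<phi>))"
      unfolding dia_trancl_iff by blast
  qed
  then show "?ax \<in> L"
    unfolding imp_iff_ext ext_dia_plus ext_diff ext_dia by blast
qed

text \<open>As \<open>n\<close> is positive, \<open>box_plus n \<phi>\<close> implies the box of
  \<open>\<phi>\<close>, which gives one direction. For the other, a maximal point refuting
  \<open>\<phi>\<close> satisfies \<open>box_plus n \<phi>\<close>, hence
  \<open>\<phi>\<close>.\<close>

lemma box_plus_rule_iff:
  "(\<forall>\<phi>. box_plus n \<phi> \<^bold>\<rightarrow> \<phi> \<in> L \<longrightarrow> \<phi> \<in> L) \<longleftrightarrow> box_rule"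
proof
  assume rule: "\<forall>\<phi>. box_plus n \<phi> \<^bold>\<rightarrow> \<phi> \<in> L \<longrightarrow> \<phi> \<in> L"
  have "\<box> \<phi> \<in> w" if "world L w" "box_plus n \<phi> \<in> w" for w \<phi>
  proof -
    have "dia_pow 1 (\<^bold>\<not> \<phi>) \<notin> w"
      using that(2) n unfolding world_box_plus[OF that(1)] by force
    then show ?thesis using that(1) by (simp add: dia_pow_def)
  qed
  then have "box_plus n \<phi> \<^bold>\<rightarrow> \<phi> \<in> L" if "\<box> \<phi> \<^bold>\<rightarrow> \<phi> \<in> L" for \<phi>
    using that unfolding imp_iff_ext ext_def by blast
  then show box_rule using rule unfolding box_rule_def by blast
next
  assume br: box_rule
  show "\<forall>\<phi>. box_plus n \<phi> \<^bold>\<rightarrow> \<phi> \<in> L \<longrightarrow> \<phi> \<in> L"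
  proof (intro allI impI, rule ccontr)
    fix \<phi> assume imp: "box_plus n \<phi> \<^bold>\<rightarrow> \<phi> \<in> L" and "\<phi> \<notin> L"
    then obtain x where "world L x" "\<phi> \<notin> x" using complete by blast
    then have "x \<in> ext L (\<^bold>\<not> \<phi>)" by (simp add: ext_def)
    then obtain v where v: "v \<in> ext L (\<^bold>\<not> \<phi>)" "v \<notin> ext L (dia_plus n (\<^bold>\<not> \<phi>))"
      using maximal[OF br rangeI] unfolding ext_dia_plus by blast
    then have w: "world L v" and "\<phi> \<notin> v" "dia_plus n (\<^bold>\<not> \<phi>) \<notin> v"
      by (auto simp: ext_def)
    then have "box_plus n \<phi> \<in> v"
      unfolding world_dia_plus[OF w] world_box_plus[OF w] by blast
    then show False using world_mp[OF w world_L[OF w imp]] \<open>\<phi> \<notin> v\<close> by blast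
  qed
qed

lemma gl_axiom:
  assumes "0 \<notin> depths \<alpha>" "\<diamond> sp_fm p \<alpha> \<^bold>\<rightarrow> \<diamond> Var p \<^bold>\<or> Var p \<in> L" box_rule
  shows "\<diamond> Var p \<^bold>\<rightarrow> \<diamond> (Var p \<^bold>\<and> \<^bold>\<not> sp_fm p \<alpha>) \<in> L"
proof -
  interpret loeb_frame "{w. world L w}" "acc L" "range (ext L)" \<alpha>
  proof
    fix X assume "X \<in> range (ext L)"
    then obtain \<phi> where X: "X = ext L \<phi>" by blast
    have "\<diamond> inst \<phi> \<alpha> \<^bold>\<rightarrow> \<diamond> \<phi> \<^bold>\<or> \<phi> \<in> L"
      using substI[OF assms(2), of "\<lambda>_. \<phi>"] by (simp add: subst_sp_fm)
    then show "dia (den X \<alpha>) \<subseteq> dia X \<union> X"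
      unfolding imp_iff_ext ext_or ext_dia ext_inst X .
  next
    fix X assume X: "X \<in> range (ext L)" "X \<noteq> {}"
    then obtain x where "x \<in> X" by blast
    from maximal[OF assms(3) X(1) this]
    show "\<exists>x\<in>X. \<forall>y. (acc L)\<^sup>+\<^sup>+ x y \<longrightarrow> y \<notin> X"
      by (auto simp: dia_trancl_iff)
  qed (rule assms(1))
  show ?thesis
    using gl[OF rangeI] unfolding imp_iff_ext ext_diff ext_dia sp_fm_inst ext_inst .
qed

end

section \<open>Logics containing the GL axiom\<close>

locale gl_logic = logic +
  fixes p :: nat and \<alpha> :: sp
  assumes gl_ax: "\<diamond> Var p \<^bold>\<rightarrow> \<diamond> (Var p \<^bold>\<and> \<^bold>\<not> sp_fm p \<alpha>) \<in> L"
begin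

lemma gl_ext: "dia (ext L \<phi>) \<subseteq> dia (ext L \<phi> - den (ext L \<phi>) \<alpha>)"
proof -
  have "\<diamond> \<phi> \<^bold>\<rightarrow> \<diamond> (\<phi> \<^bold>\<and> \<^bold>\<not> inst \<phi> \<alpha>) \<in> L"
    using substI[OF gl_ax, of "\<lambda>_. \<phi>"] by (simp add: subst_sp_fm)
  then show ?thesis
    unfolding imp_iff_ext ext_diff ext_dia ext_inst .
qed

text \<open>As in the classical derivation of transitivity from Loeb's axiom, the GL axiom is
  applied to the union \<open>Y\<close> of \<open>X\<close> and \<open>den X \<alpha>\<close>. A
  point of \<open>Y\<close> outside \<open>den Y \<alpha>\<close> is outside
  \<open>den X \<alpha>\<close> by monotonicity, hence in \<open>X\<close>.\<close>

lemma gl_K4: "\<diamond> sp_fm p \<alpha> \<^bold>\<rightarrow> \<diamond> Var p \<in> L"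
proof -
  define X where "X = ext L (Var p)"
  define Y where "Y = X \<union> den X \<alpha>"
  have "Y = ext L (Var p \<^bold>\<or> inst (Var p) \<alpha>)"
    by (simp only: Y_def X_def ext_or ext_inst)
  then have "dia Y \<subseteq> dia (Y - den Y \<alpha>)"
    using gl_ext[of "Var p \<^bold>\<or> inst (Var p) \<alpha>"] by simp
  moreover have "den X \<alpha> \<subseteq> den Y \<alpha>"
    by (rule den_mono) (simp add: Y_def)
  ultimately have "dia (den X \<alpha>) \<subseteq> dia X"
    unfolding Y_def dia_def by blast
  then show ?thesis
    unfolding imp_iff_ext ext_dia sp_fm_inst ext_inst X_def .
qed

lemma gl_wK4: "\<diamond> sp_fm p \<alpha> \<^bold>\<rightarrow> \<diamond> Var p \<^bold>\<or> Var p \<in> L"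
  using gl_K4 unfolding imp_iff_ext ext_or by blast

text \<open>If every point of \<open>X\<close> has a successor in \<open>X\<close>, every strictly
  positive tree can be grown inside \<open>X\<close>; then the GL axiom leaves no point of
  \<open>X\<close> to be seen.\<close>

lemma gl_box_rule: box_rule
  unfolding box_rule_iff
proof (intro ballI impI)
  fix X assume X_D: "X \<in> range (ext L)" and X: "X \<subseteq> dia X"
  have "X \<subseteq> den X \<alpha>"
    using den_if_serial[OF D_W[OF X_D] X] .
  moreover have "dia X \<subseteq> dia (X - den X \<alpha>)"
    using X_D gl_ext by fast
  ultimately show "X = {}"
    using X unfolding dia_def by blast
qed

end

section \<open>Comparing the least extensions\<close>

lemma is_logic_Inter:
  assumes "\<And>L. L \<in> C \<Longrightarrow> is_logic L"
  shows "is_logic (\<Inter>C)"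
proof -
  have L: "logic L" if "L \<in> C" for L
    using assms[OF that] by (rule logic.intro)
  show ?thesis
    unfolding is_logic_def tautology_def
  proof (intro conjI allI impI InterI)
    fix L \<phi> \<psi> assume "L \<in> C" "\<phi> \<^bold>\<rightarrow> \<psi> \<in> \<Inter>C" "\<phi> \<in> \<Inter>C"
    then show "\<psi> \<in> L" using logic.mp[OF L] by blast
  qed (use L in \<open>simp_all add: logic.taut logic.dia_bot logic.dia_or logic.substI logic.mono\<close>)
qed

lemma finite_depths: "finite (depths t)"
proof (induction t)
  case (SP_Dia t)
  then show ?case by (simp add: setcompr_eq_image)
qed auto

lemma depths_if_min_depth: "min_depth t \<ge> 1 \<Longrightarrow> 0 \<notin> depths t"
proof
  assume "min_depth t \<ge> 1" "0 \<in> depths t"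
  moreover have "min_depth t \<le> enat 0"
    unfolding min_depth_def using finite_depths \<open>0 \<in> depths t\<close> by (intro Min_le) auto
  ultimately show False by (simp add: zero_enat_def[symmetric])
qed

theorem theorem6p1:
  fixes p n :: nat and \<alpha> :: sp and \<beta> :: fm and \<Lambda> :: "fm set"
  assumes "\<beta> = sp_fm p \<alpha>"
    and "p \<in> vars \<beta>"
    and "min_depth \<alpha> \<ge> 1"
    and "\<Lambda> \<in> {K4_dia p \<beta>, wK4_dia p \<beta>}"
    and "n \<ge> 1"
    and "transitive_logic n \<Lambda>"
  shows
    "add_axiom \<Lambda> (dia_plus n (Var p) \<^bold>\<rightarrow> dia_plus n (Var p \<^bold>\<and> \<^bold>\<not> dia_plus n (Var p)))
       = GL_dia p \<beta> \<and>
     add_axiom \<Lambda> (\<diamond> Var p \<^bold>\<rightarrow> dia_plus n (Var p \<^bold>\<and> \<^bold>\<not> \<diamond> Var p)) = GL_dia p \<beta> \<and>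
     add_rule \<Lambda> {(box_plus n \<phi> \<^bold>\<rightarrow> \<phi>, \<phi>) | \<phi>. True} = GL_dia p \<beta> \<and>
     add_rule \<Lambda> {(\<box> \<phi> \<^bold>\<rightarrow> \<phi>, \<phi>) | \<phi>. True} = GL_dia p \<beta>"
proof -
  \<comment> \<open>A copy of \<open>box_rule\<close> as a predicate on arbitrary sets of formulas,
    so that logics extending \<open>\<Lambda>\<close> can be compared outside the locale.\<close>
  define box_closed where
    "box_closed M \<longleftrightarrow> (\<forall>\<phi>. \<box> \<phi> \<^bold>\<rightarrow> \<phi> \<in> M \<longrightarrow> \<phi> \<in> M)" for M :: "fm set"
  define Ext where "Ext = {M. is_logic M \<and> \<Lambda> \<subseteq> M}"
  let ?G = "GL_dia p \<beta>"
  have G_logic: "is_logic ?G"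
    unfolding GL_dia_def add_axiom_def by (rule is_logic_Inter) blast
  have G_ax: "\<diamond> Var p \<^bold>\<rightarrow> \<diamond> (Var p \<^bold>\<and> \<^bold>\<not> sp_fm p \<alpha>) \<in> ?G"
    unfolding GL_dia_def add_axiom_def assms(1) by blast
  interpret G: gl_logic ?G p \<alpha>
    by unfold_locales (fact G_logic, fact G_ax)
  have K: "logic_K \<subseteq> M" if "is_logic M" for M
    using that unfolding logic_K_def by blast
  have "K4_dia p \<beta> \<subseteq> ?G" "wK4_dia p \<beta> \<subseteq> ?G"
    using G_logic K[OF G_logic] G.gl_K4 G.gl_wK4
    unfolding K4_dia_def wK4_dia_def add_axiom_def assms(1) by blast+
  then have G_Ext: "?G \<in> Ext"
    using assms(4) G_logic unfolding Ext_def by blast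
  have trans: "pretransitive_logic M n" if "M \<in> Ext" for M
    using that assms(5,6) unfolding Ext_def transitive_logic_def
    by unfold_locales (auto simp: transitive_logic_def)
  have box_closed: "logic.box_rule M = box_closed M" if "M \<in> Ext" for M
    using that logic.box_rule_def[of M] unfolding Ext_def box_closed_def logic_def by blast
  have least: "?G \<subseteq> M" if "M \<in> Ext" "box_closed M" for M
  proof -
    interpret M: pretransitive_logic M n using trans[OF that(1)] .
    \<comment> \<open>The K4 axiom implies the wK4 axiom, so both choices of
      \<open>\<Lambda>\<close> reduce to the weak one.\<close>
    have "\<diamond> sp_fm p \<alpha> \<^bold>\<rightarrow> \<diamond> Var p \<in> \<Lambda> \<or> \<diamond> sp_fm p \<alpha> \<^bold>\<rightarrow> \<diamond> Var p \<^bold>\<or> Var p \<in> \<Lambda>"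
      using assms(4) unfolding K4_dia_def wK4_dia_def add_axiom_def assms(1) by blast
    then have "\<diamond> sp_fm p \<alpha> \<^bold>\<rightarrow> \<diamond> Var p \<^bold>\<or> Var p \<in> M"
      using that(1) unfolding Ext_def M.imp_iff_ext M.ext_or M.imp_iff_ext[symmetric]
      using M.imp_iff_ext M.ext_or by blast
    then have "\<diamond> Var p \<^bold>\<rightarrow> \<diamond> (Var p \<^bold>\<and> \<^bold>\<not> sp_fm p \<alpha>) \<in> M"
      using M.gl_axiom[OF depths_if_min_depth[OF assms(3)]] that box_closed by blast
    then show ?thesis
      using that(1) K unfolding GL_dia_def add_axiom_def assms(1) Ext_def by blast
  qed
  \<comment> \<open>Each of the four logics is the intersection of the members of \<open>Ext\<close>
    with a property equivalent to \<open>box_closed\<close>; GL is itself such a member and is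
    contained in all others.\<close>
  have eq: "\<Inter>{M \<in> Ext. Q M} = ?G" if "\<And>M. M \<in> Ext \<Longrightarrow> Q M \<longleftrightarrow> box_closed M" for Q
  proof -
    have "box_closed ?G" using box_closed[OF G_Ext] G.gl_box_rule by blast
    then show ?thesis using that G_Ext least by blast
  qed
  have axiom: "add_axiom \<Lambda> \<phi> = \<Inter>{M \<in> Ext. \<phi> \<in> M}" for \<phi>
    unfolding add_axiom_def Ext_def by (rule arg_cong[of _ _ Inter]) blast
  have rule: "add_rule \<Lambda> {(f \<phi> \<^bold>\<rightarrow> \<phi>, \<phi>) | \<phi>. True} =
      \<Inter>{M \<in> Ext. \<forall>\<phi>. f \<phi> \<^bold>\<rightarrow> \<phi> \<in> M \<longrightarrow> \<phi> \<in> M}" for f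
    unfolding add_rule_def Ext_def by (rule arg_cong[of _ _ Inter]) blast
  show ?thesis
    unfolding axiom rule
    using pretransitive_logic.trancl_axiom_iff[OF trans]
      pretransitive_logic.dia_axiom_iff[OF trans]
      pretransitive_logic.box_plus_rule_iff[OF trans] box_closed
    by (intro conjI eq) (auto simp: box_closed_def)
qed

end
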